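(* For every integer $a\ge1$ and $s\in\mathbb{C}$, $$I^T_{\boldsymbol{a}}(s)=\left( \sum_{i=0}^{a-1} \binom{s+i}{i} T^i \right) \zeta(s+a+1).$$
   Context: Here $T$ is an indeterminate and $\zeta$ is the Riemann zeta function. For a positive integer $a$, $\boldsymbol{a}=(\underbrace{1,\ldots,1}_{a-1},2)$, and for $\Re(s)>-1$ one defines $$I^T_{\boldsymbol{a}}(s) :=\frac{1}{(a-1)!\, \Gamma (s+1) } \int_{0<t_1<t_{2}<1} \frac{dt_1\, dt_{2}}{(1-t_1)t_2 } \left( \log \frac{1-t_1}{1-t_2} + T \log \frac{t_2}{t_1} \right)^{a-1}\left( \log \frac{t_2 }{t_1 } \right)^{s},$$ a polynomial in $T$ (the integral being taken coefficientwise after expanding in powers of $T$). For other $s\in\mathbb{C}$, $I^T_{\boldsymbol{a}}(s)$ is understood via meromorphic continuation in $s$ of each coefficient of $T^i$. The binomial coefficient is $\binom{s+i}{i}=\frac{(s+1)(s+2)\cdots(s+i)}{i!}$, equal to $1$ for $i=0$. *)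

theory Defs
  imports
    "HOL-Complex_Analysis.Complex_Analysis"
    "HOL-Computational_Algebra.Polynomial"
begin

text \<open>
  The meromorphic function on the complex plane that extends \<open>f\<close> from \<open>U\<close>. Asking for
  \<^const>\<open>nicely_meromorphic_on\<close> fixes the pointwise values: removable singularities are filled in,
  and the value at a pole is \<open>0\<close>. Two continuations that agree at all points agree as meromorphic
  functions, so they also have the same poles.
\<close>
definition meromorphic_continuation ::
    "complex set \<Rightarrow> (complex \<Rightarrow> complex) \<Rightarrow> complex \<Rightarrow> complex" where
  "meromorphic_continuation U f =
     (THE F. F nicely_meromorphic_on UNIV \<and> (\<forall>s\<in>U. F s = f s))"

lemma nicely_meromorphic_unique:
  assumes F: "F nicely_meromorphic_on UNIV" and G: "G nicely_meromorphic_on UNIV"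
    and U: "open U" "U \<noteq> {}" and eq: "\<And>s. s \<in> U \<Longrightarrow> F s = G s"
  shows "F = G"
proof -
  let ?D = "\<lambda>z. F z - G z"
  obtain z where z: "z \<in> U" using U by auto
  have mero: "F meromorphic_on UNIV" "G meromorphic_on UNIV"
    using F G by (auto simp: nicely_meromorphic_on_def)
  have D: "?D meromorphic_on UNIV"
    by (intro meromorphic_intros mero)
  have near: "eventually (\<lambda>w. ?D w = 0) (at z)"
    using eventually_at_in_open'[OF U(1) z] by eventually_elim (simp add: eq)
  have "\<not> eventually (\<lambda>w. ?D w \<noteq> 0) (cosparse UNIV)"
  proof
    assume "eventually (\<lambda>w. ?D w \<noteq> 0) (cosparse UNIV)"
    then have "eventually (\<lambda>w. ?D w \<noteq> 0) (at z)"
      by (rule eventually_cosparse_imp_eventually_at) auto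
    with near have "eventually (\<lambda>w. False) (at z)"
      by eventually_elim simp
    then show False by simp
  qed
  then have ev: "eventually (\<lambda>w. ?D w = 0) (cosparse UNIV)"
    using meromorphic_imp_constant_or_avoid[OF D, of 0] by auto
  show ?thesis
  proof
    fix s
    have ev': "eventually (\<lambda>w. F w = G w) (at s)"
      using eventually_cosparse_imp_eventually_at[OF ev, of s UNIV] by simp
    show "F s = G s"
    proof (cases "is_pole F s")
      case True
      then have "is_pole G s" using ev' is_pole_cong by blast
      with True F G show ?thesis
        unfolding nicely_meromorphic_on_def using not_tendsto_and_filterlim_at_infinity[of "at s"]
        by (metis UNIV_I at_neq_bot is_pole_def)
    next
      case False
      then have nG: "\<not> is_pole G s" using ev' is_pole_cong by blast
      from False F have "F \<midarrow>s\<rightarrow> F s" by (auto simp: nicely_meromorphic_on_def)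
      then have "G \<midarrow>s\<rightarrow> F s" using tendsto_cong[OF ev'] by auto
      moreover from nG G have "G \<midarrow>s\<rightarrow> G s" by (auto simp: nicely_meromorphic_on_def)
      ultimately show ?thesis using LIM_unique by blast
    qed
  qed
qed

lemma meromorphic_continuation_eqI:
  assumes "F nicely_meromorphic_on UNIV" "open U" "U \<noteq> {}" "\<And>s. s \<in> U \<Longrightarrow> F s = f s"
  shows "meromorphic_continuation U f = F"
  unfolding meromorphic_continuation_def
proof (rule the_equality)
  show "F nicely_meromorphic_on UNIV \<and> (\<forall>s\<in>U. F s = f s)" using assms by blast
next
  fix G assume "G nicely_meromorphic_on UNIV \<and> (\<forall>s\<in>U. G s = f s)"
  then show "G = F"
    using nicely_meromorphic_unique[of G F U] assms by auto
qed

definition zeta :: "complex \<Rightarrow> complex" where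
  "zeta = meromorphic_continuation {s. Re s > 1} (\<lambda>s. \<Sum>n. 1 / of_nat (Suc n) powr s)"

text \<open>
  The coefficient of \<open>T^i\<close> in the integrand. The linear polynomial in \<open>T\<close> is
  \<open>log ((1 - t1) / (1 - t2)) + T log (t2 / t1)\<close>; on the domain of integration
  \<open>log (t2 / t1) > 0\<close>, so the complex power is the usual one.
\<close>
definition I_integrand :: "nat \<Rightarrow> nat \<Rightarrow> complex \<Rightarrow> real \<times> real \<Rightarrow> complex" where
  "I_integrand a i s = (\<lambda>(t1, t2).
     1 / of_real ((1 - t1) * t2)
     * of_real (coeff ([: ln ((1 - t1) / (1 - t2)), ln (t2 / t1) :] ^ (a - 1)) i)
     * of_real (ln (t2 / t1)) powr s)"

definition I_integral :: "nat \<Rightarrow> nat \<Rightarrow> complex \<Rightarrow> complex" where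
  "I_integral a i s =
     1 / (fact (a - 1) * Gamma (s + 1))
     * (LINT t:{(t1, t2). 0 < t1 \<and> t1 < t2 \<and> t2 < 1}|lborel. I_integrand a i s t)"

text \<open>
  \<open>I^T\<close> for the index \<open>(1, \<dots>, 1, 2)\<close> with \<open>a - 1\<close> ones, as a polynomial in \<open>T\<close>. The integrand
  has degree at most \<open>a - 1\<close> in \<open>T\<close>, so there are no further coefficients.
\<close>
definition I_poly :: "nat \<Rightarrow> complex \<Rightarrow> complex poly" where
  "I_poly a s =
     (\<Sum>i<a. monom (meromorphic_continuation {s. Re s > -1} (I_integral a i) s) i)"

end

theory Submission
  imports Defs
begin

text \<open>
  Write \<open>u = ln (t2 / t1)\<close> and \<open>v = ln ((1 - t1) / (1 - t2))\<close> for the two logarithms in the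
  integrand. They are coordinates that map the triangle \<open>0 < t1 < t2 < 1\<close> bijectively onto the
  quadrant \<open>u, v > 0\<close>, and they turn the measure \<open>dt1 dt2 / ((1 - t1) t2)\<close> into
  \<open>du dv / (exp (u + v) - 1)\<close> (lemma \<open>distr_log_coords\<close>). By the binomial theorem the coefficient of
  \<open>T^i\<close> in the integrand is a multiple of \<open>v^m u^(s+i)\<close> with \<open>m = a - 1 - i\<close>. Expanding
  \<open>1 / (exp (u + v) - 1)\<close> as the geometric series of the \<open>exp (-n u) exp (-n v)\<close> with \<open>n \<ge> 1\<close>
  separates the variables: each term is a product of two Gamma integrals, with value
  \<open>m! / n^(m+1) * Gamma (s+i+1) / n^(s+i+1)\<close>, and the sum over \<open>n\<close> is
  \<open>m! Gamma (s+i+1) zeta (s+a+1)\<close> (lemma \<open>has_bochner_integral_quadrant\<close>). After division by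
  \<open>Gamma (s+1)\<close> the Gamma factors and the factorials combine to the binomial coefficient, which
  proves the formula for \<open>Re s > -1\<close> (lemma \<open>I_integral_eq\<close>).

  For the remaining \<open>s\<close> it has to be known that the right-hand side is meromorphic, with the values
  that \<^const>\<open>nicely_meromorphic_on\<close> prescribes. The continuation of \<^const>\<open>zeta\<close> comes from the
  alternating series \<open>1 - 2^(-s) + 3^(-s) - \<dots> = (1 - 2^(1-s)) zeta s\<close>, which repeated averaging of
  consecutive terms continues to an entire function. Multiplication by the binomial coefficient
  could only destroy a pole of \<open>zeta (s+a+1)\<close> at a zero of the binomial coefficient; these zeros are
  \<open>s = -1, \<dots>, -i\<close>, where \<open>s + a + 1 \<ge> 2\<close> because \<open>i < a\<close>, and \<^const>\<open>zeta\<close> has no pole to the right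
  of \<open>1\<close> (lemma \<open>binomial_zeta_nicely_meromorphic\<close>).
\<close>

section \<open>Continuation of the alternating zeta series\<close>

text \<open>
  Up to the sign \<open>(-1)^k\<close>, the \<open>k\<close>-th forward difference of \<open>x^(-s)\<close> as a function of \<open>x\<close>. Taking
  differences of the terms of an alternating series is the same as averaging its consecutive terms.
\<close>
primrec power_diff :: "nat \<Rightarrow> complex \<Rightarrow> real \<Rightarrow> complex" where
  "power_diff 0 s x = of_real x powr (-s)"
| "power_diff (Suc k) s x = power_diff k s x - power_diff k s (x + 1)"

lemma power_diff_has_vector_derivative:
  assumes "x > 0"
  shows "(power_diff k s has_vector_derivative (- s * power_diff k (s + 1) x)) (at x)"
  using assms
proof (induction k arbitrary: x)
  case 0
  have "((\<lambda>x. of_real x powr (-s)) has_vector_derivative (- s * of_real x powr (-s - 1))) (at x)"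
    using 0
    by (intro has_vector_derivative_real_field)
       (auto intro!: derivative_eq_intros simp: complex_nonpos_Reals_iff)
  moreover have "-s - 1 = - (s + 1)" by simp
  ultimately show ?case by (simp only: power_diff.simps)
next
  case (Suc k)
  have "(power_diff k s has_vector_derivative (- s * power_diff k (s + 1) (x + 1))) (at (x + 1))"
    using Suc by auto
  moreover have "((\<lambda>y. y + 1) has_vector_derivative 1) (at x)"
    by (auto intro!: derivative_eq_intros)
  ultimately have "((\<lambda>y. power_diff k s (y + 1)) has_vector_derivative
      (- s * power_diff k (s + 1) (x + 1))) (at x)"
    using vector_diff_chain_at[of "\<lambda>y. y + 1" 1 x "power_diff k s"] by (simp add: o_def)
  from has_vector_derivative_diff[OF Suc.IH[OF Suc.prems] this]
  show ?case by (simp add: algebra_simps)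
qed

text \<open>
  Every difference gains one power of \<open>x\<close> in decay, just as differentiation would: by the mean value
  inequality a difference is bounded by the derivative, which is \<open>-s\<close> times a difference of lower
  order for the exponent \<open>s + 1\<close>. The products of these factors build up the Pochhammer symbol.
  The condition on \<open>Re s + k\<close> makes the bound decreasing in \<open>x\<close>, so that it may be taken at the left
  end of the interval.
\<close>
lemma norm_power_diff_le:
  assumes "x > 0" "Re s + real k \<ge> 0"
  shows "norm (power_diff k s x) \<le> norm (pochhammer s k) * x powr (- (Re s + real k))"
  using assms
proof (induction k arbitrary: s x)
  case 0
  then show ?case by (simp add: norm_powr_real_powr)
next
  case (Suc k)
  let ?B = "norm (pochhammer s (Suc k)) * x powr (- (Re s + real (Suc k)))"
  have "norm (power_diff k s (x + 1) - power_diff k s x) \<le> ?B * norm ((x + 1) - x)"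
  proof (rule differentiable_bound[where S = "{x..x+1}" and f' = "\<lambda>y h. h *\<^sub>R (- s * power_diff k (s + 1) y)"])
    fix y assume y: "y \<in> {x..x+1}"
    then have "y > 0" using Suc.prems by auto
    show "(power_diff k s has_derivative (\<lambda>h. h *\<^sub>R (- s * power_diff k (s + 1) y))) (at y within {x..x+1})"
      using has_vector_derivative_at_within[OF power_diff_has_vector_derivative[OF \<open>y > 0\<close>]]
      unfolding has_vector_derivative_def .
    have "norm (power_diff k (s + 1) y) \<le> norm (pochhammer (s + 1) k) * y powr (- (Re (s + 1) + real k))"
      using Suc.IH[of y "s + 1"] Suc.prems \<open>y > 0\<close> by (simp add: algebra_simps)
    also have "\<dots> \<le> norm (pochhammer (s + 1) k) * x powr (- (Re (s + 1) + real k))"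
      using y Suc.prems by (intro mult_left_mono powr_mono2') auto
    finally have "norm s * norm (power_diff k (s + 1) y)
        \<le> norm s * (norm (pochhammer (s + 1) k) * x powr (- (Re (s + 1) + real k)))"
      by (rule mult_left_mono) auto
    then have "norm (- s * power_diff k (s + 1) y) \<le> ?B"
      by (simp add: norm_mult pochhammer_rec algebra_simps)
    then show "onorm (\<lambda>h. h *\<^sub>R (- s * power_diff k (s + 1) y)) \<le> ?B"
    proof (intro onorm_le)
      fix h :: real
      show "norm (h *\<^sub>R (- s * power_diff k (s + 1) y)) \<le> ?B * norm h"
        unfolding norm_scaleR real_norm_def mult.commute[of "\<bar>h\<bar>"]
        using \<open>norm (- s * power_diff k (s + 1) y) \<le> ?B\<close> by (rule mult_right_mono) simp
    qed
  qed auto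
  then show ?case by (simp add: norm_minus_commute)
qed

lemma holomorphic_power_diff [holomorphic_intros]:
  assumes "x > 0"
  shows "(\<lambda>s. power_diff k s x) holomorphic_on A"
  using assms by (induction k arbitrary: x) (auto intro!: holomorphic_intros)

definition alternating_sum :: "nat \<Rightarrow> complex \<Rightarrow> complex" where
  "alternating_sum k s = (\<Sum>n. (-1) ^ n * power_diff k s (real (Suc n)))"

lemma summable_Suc_powr:
  fixes e :: real
  assumes "e > 1"
  shows "summable (\<lambda>n. real (Suc n) powr (- e))"
  using assms by (subst summable_Suc_iff[of "\<lambda>n. real n powr (-e)"]) (simp add: summable_real_powr_iff)

lemma summable_alternating_power_diff:
  assumes "Re s > 1 - real k"
  shows "summable (\<lambda>n. (-1) ^ n * power_diff k s (real (Suc n)))"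
proof (rule summable_comparison_test)
  show "summable (\<lambda>n. norm (pochhammer s k) * real (Suc n) powr (- (Re s + real k)))"
    using assms by (intro summable_mult summable_Suc_powr) auto
  show "\<exists>N. \<forall>n\<ge>N. norm ((-1) ^ n * power_diff k s (real (Suc n)))
      \<le> norm (pochhammer s k) * real (Suc n) powr (- (Re s + real k))"
    using assms norm_power_diff_le[of "real (Suc n)" s k for n] 
    by (intro exI[of _ 0]) (auto simp: norm_mult norm_power)
qed

text \<open>
  The decay of the \<open>k\<close>-th difference makes the series converge locally uniformly \<open>k\<close> units further
  to the left than the series of the \<open>n^(-s)\<close>.
\<close>
lemma holomorphic_alternating_sum:
  "alternating_sum k holomorphic_on {s. Re s > 1 - real k}"
proof (rule holomorphic_uniform_sequence)
  show "open {s. Re s > 1 - real k}" by (rule open_halfspace_Re_gt)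
  show "(\<lambda>s. \<Sum>n<N. (-1) ^ n * power_diff k s (real (Suc n))) holomorphic_on {s. Re s > 1 - real k}" for N
    by (intro holomorphic_intros) auto
  fix z assume z: "z \<in> {s. Re s > 1 - real k}"
  define d where "d = (Re z + real k - 1) / 2"
  have d: "d > 0" using z by (simp add: d_def)
  have ge: "Re s + real k \<ge> 1 + d" if "s \<in> cball z d" for s
    using that abs_Re_le_cmod[of "z - s"] by (auto simp: d_def dist_norm field_simps)
  have "compact ((\<lambda>s. pochhammer s k) ` cball z d)"
    by (intro compact_continuous_image continuous_intros) auto
  then have "bounded ((\<lambda>s. pochhammer s k) ` cball z d)"
    by (rule compact_imp_bounded)
  then obtain B where B: "\<And>s. s \<in> cball z d \<Longrightarrow> norm (pochhammer s k) \<le> B"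
    unfolding bounded_iff by blast
  have "uniform_limit (cball z d) (\<lambda>N s. \<Sum>n<N. (-1) ^ n * power_diff k s (real (Suc n)))
      (alternating_sum k) sequentially"
    unfolding alternating_sum_def
  proof (rule Weierstrass_m_test)
    show "summable (\<lambda>n. B * real (Suc n) powr (- (1 + d)))"
      using d by (intro summable_mult summable_Suc_powr) auto
    fix n s assume s: "s \<in> cball z d"
    have "norm (power_diff k s (real (Suc n))) \<le> norm (pochhammer s k) * real (Suc n) powr (- (Re s + real k))"
      using ge[OF s] d by (intro norm_power_diff_le) auto
    also have "\<dots> \<le> B * real (Suc n) powr (- (1 + d))"
      using ge[OF s] B[OF s] order_trans[OF norm_ge_zero B[OF s]]
      by (intro mult_mono powr_mono) auto
    finally show "norm ((-1) ^ n * power_diff k s (real (Suc n))) \<le> B * real (Suc n) powr (- (1 + d))"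
      by (simp add: norm_mult norm_power)
  qed
  moreover have "cball z d \<subseteq> {s. Re s > 1 - real k}"
    using ge d by fastforce
  ultimately show "\<exists>d>0. cball z d \<subseteq> {s. Re s > 1 - real k} \<and>
      uniform_limit (cball z d) (\<lambda>N s. \<Sum>n<N. (-1) ^ n * power_diff k s (real (Suc n)))
        (alternating_sum k) sequentially"
    using d by blast
qed

text \<open>
  One step of Euler's series transformation: the series is averaged with its own shift.
\<close>
lemma alternating_sum_Suc:
  assumes "Re s > 1 - real k"
  shows "alternating_sum k s = power_diff k s 1 / 2 + alternating_sum (Suc k) s / 2"
proof -
  let ?f = "\<lambda>n. (-1) ^ n * power_diff k s (real (Suc n))"
  have f: "?f sums alternating_sum k s"
    unfolding alternating_sum_def using summable_alternating_power_diff[OF assms] by (rule summable_sums)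
  have f': "(\<lambda>n. ?f (Suc n)) sums (alternating_sum k s - ?f 0)"
    using f by (subst sums_Suc_iff) simp
  have "(\<lambda>n. ?f n + ?f (Suc n)) sums (alternating_sum k s + (alternating_sum k s - ?f 0))"
    by (intro sums_add f f')
  also have "(\<lambda>n. ?f n + ?f (Suc n)) = (\<lambda>n. (-1) ^ n * power_diff (Suc k) s (real (Suc n)))"
    by (simp add: algebra_simps)
  finally have "alternating_sum (Suc k) s = 2 * alternating_sum k s - power_diff k s 1"
    unfolding alternating_sum_def[of "Suc k"] by (simp add: sums_iff)
  then show ?thesis by (simp add: field_simps)
qed

text \<open>
  The alternating zeta series after \<open>k\<close> steps of the Euler transformation.
\<close>
definition eta_accelerated :: "nat \<Rightarrow> complex \<Rightarrow> complex" where
  "eta_accelerated k s = (\<Sum>j<k. power_diff j s 1 / 2 ^ Suc j) + alternating_sum k s / 2 ^ k"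

lemma eta_accelerated_eq:
  assumes "Re s > 1 - real k" "k \<le> l"
  shows "eta_accelerated l s = eta_accelerated k s"
  using assms(2)
proof (induction l rule: dec_induct)
  case (step l)
  have "Re s > 1 - real l" using assms(1) step by linarith
  then have "eta_accelerated (Suc l) s = eta_accelerated l s"
    unfolding eta_accelerated_def by (subst alternating_sum_Suc[of l]) (auto simp: field_simps)
  with step show ?case by simp
qed simp

text \<open>
  The number of steps is chosen large enough for convergence at \<open>s\<close>; by \<open>eta_accelerated_eq\<close> any
  larger number gives the same value.
\<close>
definition dirichlet_eta :: "complex \<Rightarrow> complex" where
  "dirichlet_eta s = eta_accelerated (nat \<lceil>2 - Re s\<rceil>) s"

lemma dirichlet_eta_eq:
  assumes "Re s > 1 - real k"
  shows "dirichlet_eta s = eta_accelerated k s"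
proof -
  let ?l = "nat \<lceil>2 - Re s\<rceil>"
  have "Re s > 1 - real ?l" by linarith
  then show ?thesis
    unfolding dirichlet_eta_def
    using eta_accelerated_eq[of k s "max k ?l"] eta_accelerated_eq[of ?l s "max k ?l"] assms by simp
qed

lemma dirichlet_eta_holomorphic: "dirichlet_eta holomorphic_on A"
proof -
  have "dirichlet_eta analytic_on UNIV"
    unfolding analytic_on_def
  proof
    fix z :: complex
    let ?k = "nat \<lceil>2 - Re z\<rceil>"
    let ?H = "{s. Re s > 1 - real ?k}"
    have "open ?H" "z \<in> ?H" by (auto simp: open_halfspace_Re_gt, linarith)
    then obtain e where e: "e > 0" "ball z e \<subseteq> ?H" by (meson openE)
    have "eta_accelerated ?k holomorphic_on ?H"
      unfolding eta_accelerated_def by (intro holomorphic_intros holomorphic_alternating_sum) auto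
    then have "dirichlet_eta holomorphic_on ?H"
      by (rule holomorphic_transform) (simp add: dirichlet_eta_eq)
    then show "\<exists>e>0. dirichlet_eta holomorphic_on ball z e"
      using e holomorphic_on_subset by blast
  qed
  then show ?thesis
    using analytic_imp_holomorphic holomorphic_on_subset by blast
qed

lemma zeta_series_sums:
  assumes "Re s > 1"
  shows "(\<lambda>n. 1 / of_nat (Suc n) powr s) sums (\<Sum>n. 1 / of_nat (Suc n) powr s :: complex)"
proof (rule summable_sums, rule summable_comparison_test)
  show "summable (\<lambda>n. real (Suc n) powr (- Re s))" using assms by (rule summable_Suc_powr)
  show "\<exists>N. \<forall>n\<ge>N. norm (1 / of_nat (Suc n) powr s :: complex) \<le> real (Suc n) powr (- Re s)"
  proof (intro exI[of _ 0] allI impI)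
    fix n :: nat
    have "norm (of_nat (Suc n) powr s :: complex) = real (Suc n) powr Re s"
      using norm_powr_real_powr[of "of_nat (Suc n)" s] by (simp del: of_nat_Suc)
    then show "norm (1 / of_nat (Suc n) powr s :: complex) \<le> real (Suc n) powr (- Re s)"
      by (simp only: norm_divide norm_one powr_minus_divide order_refl)
  qed
qed

text \<open>
  The alternating series differs from the zeta series by twice the sum over the even numbers, and
  that sum is \<open>2^(-s)\<close> times the whole zeta series.
\<close>
lemma dirichlet_eta_eq_zeta_series:
  assumes "Re s > 1"
  shows "dirichlet_eta s = (1 - 2 powr (1 - s)) * (\<Sum>n. 1 / of_nat (Suc n) powr s)"
proof -
  let ?a = "\<lambda>n. 1 / of_nat (Suc n) powr s :: complex"
  let ?Z = "\<Sum>n. ?a n"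
  have pd: "power_diff 0 s (real (Suc n)) = ?a n" for n
    by (simp add: powr_minus_divide del: of_nat_Suc)
  have eta: "(\<lambda>n. (-1) ^ n * ?a n) sums dirichlet_eta s"
  proof -
    have "(\<lambda>n. (-1) ^ n * power_diff 0 s (real (Suc n))) sums alternating_sum 0 s"
      unfolding alternating_sum_def using assms
      by (intro summable_sums summable_alternating_power_diff) auto
    moreover have "dirichlet_eta s = alternating_sum 0 s"
      using dirichlet_eta_eq[of 0 s] assms by (simp add: eta_accelerated_def)
    ultimately show ?thesis by (simp only: pd)
  qed
  have Z: "?a sums ?Z" by (rule zeta_series_sums[OF assms])
  have "(\<lambda>n. 2 powr (1 - s) * ?a n) sums (2 powr (1 - s) * ?Z)"
    by (intro sums_mult Z)
  moreover have "2 powr (1 - s) * ?a j = ?a (2 * j + 1) - (-1) ^ (2 * j + 1) * ?a (2 * j + 1)" for j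
  proof -
    have "of_nat (Suc (2 * j + 1)) = (2 * of_nat (Suc j) :: complex)" by simp
    moreover have "(2 * of_nat (Suc j) :: complex) powr s = 2 powr s * of_nat (Suc j) powr s"
      using powr_times_real[of 2 "of_nat (Suc j) :: complex" s] by simp
    moreover have "(2::complex) powr (1 - s) = 2 / 2 powr s"
      by (simp add: powr_diff)
    ultimately show ?thesis by (simp del: of_nat_Suc)
  qed
  ultimately have "(\<lambda>j. ?a (2 * j + 1) - (-1) ^ (2 * j + 1) * ?a (2 * j + 1)) sums (2 powr (1 - s) * ?Z)"
    by (simp only:)
  moreover have "?a n - (-1) ^ n * ?a n = 0" if "n \<notin> range (\<lambda>j. 2 * j + 1)" for n
  proof -
    have "even n" using that by (metis oddE rangeI)
    then show ?thesis by simp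
  qed
  moreover have "strict_mono (\<lambda>j::nat. 2 * j + 1)" by (simp add: strict_mono_def)
  ultimately have odd: "(\<lambda>n. ?a n - (-1) ^ n * ?a n) sums (2 powr (1 - s) * ?Z)"
    by (intro iffD1[OF sums_mono_reindex[of "\<lambda>j. 2 * j + 1" "\<lambda>n. ?a n - (-1) ^ n * ?a n"]])
  have "?Z - dirichlet_eta s = 2 powr (1 - s) * ?Z"
    by (rule sums_unique2[OF sums_diff[OF Z eta] odd])
  moreover have "e = (1 - p) * z" if "z - e = p * z" for e p z :: complex
    using that by (simp add: algebra_simps)
  ultimately show ?thesis by blast
qed

section \<open>The zeta function as a meromorphic function\<close>

lemma two_powr_one_minus_neq_1:
  assumes "Re s > 1"
  shows "2 powr (1 - s) \<noteq> (1 :: complex)"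
proof -
  have "norm (2 powr (1 - s) :: complex) = 2 powr (1 - Re s)"
    by (subst norm_powr_real_powr) auto
  also have "\<dots> < 2 powr 0"
    using assms by (intro powr_less_mono) auto
  finally show ?thesis by auto
qed

text \<open>
  The quotient of the entire function \<^const>\<open>dirichlet_eta\<close> by \<open>1 - 2^(1-s)\<close> continues the zeta
  series. All zeros of the denominator have real part \<open>1\<close>, so there is no pole to the right of
  that line. Some of them are removable singularities of the quotient; \<^const>\<open>remove_sings\<close> gives
  the values there that \<^const>\<open>nicely_meromorphic_on\<close> prescribes.
\<close>
lemma
  shows zeta_nicely_meromorphic: "zeta nicely_meromorphic_on UNIV"
    and zeta_eq_series: "Re s > 1 \<Longrightarrow> zeta s = (\<Sum>n. 1 / of_nat (Suc n) powr s)"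
    and not_is_pole_zeta: "Re s > 1 \<Longrightarrow> \<not> is_pole zeta s"
proof -
  let ?q = "\<lambda>s. dirichlet_eta s / (1 - 2 powr (1 - s))" and ?H = "{s. Re s > 1}"
  have eta: "dirichlet_eta analytic_on UNIV"
    by (simp add: analytic_on_open dirichlet_eta_holomorphic)
  have "?q meromorphic_on UNIV"
    by (intro meromorphic_intros analytic_on_imp_meromorphic_on eta analytic_intros) auto
  then have nice: "remove_sings ?q nicely_meromorphic_on UNIV"
    by (rule remove_sings_nicely_meromorphic)
  have "?q analytic_on {s}" if "Re s > 1" for s
    using two_powr_one_minus_neq_1[OF that]
    by (intro analytic_intros analytic_on_subset[OF eta]) auto
  then have eq: "remove_sings ?q s = ?q s" if "Re s > 1" for s
    using that by (intro remove_sings_at_analytic) auto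
  have series: "?q s = (\<Sum>n. 1 / of_nat (Suc n) powr s)" if "Re s > 1" for s
    using dirichlet_eta_eq_zeta_series[OF that] two_powr_one_minus_neq_1[OF that] by simp
  have openH: "open ?H" by (rule open_halfspace_Re_gt)
  have "(2::complex) \<in> ?H" by simp
  then have nonempty: "?H \<noteq> {}" by blast
  have zeta: "zeta = remove_sings ?q"
    unfolding zeta_def
    by (intro meromorphic_continuation_eqI[OF nice openH nonempty]) (simp add: eq series del: of_nat_Suc)
  show "zeta nicely_meromorphic_on UNIV" using nice zeta by simp
  show "zeta s = (\<Sum>n. 1 / of_nat (Suc n) powr s)" if "Re s > 1"
    using eq[OF that] series[OF that] zeta by simp
  have "?q holomorphic_on ?H"
    using two_powr_one_minus_neq_1 by (intro holomorphic_intros dirichlet_eta_holomorphic) auto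
  then have "zeta holomorphic_on ?H"
    by (rule holomorphic_transform) (simp add: zeta eq)
  then show "\<not> is_pole zeta s" if "Re s > 1"
    using not_is_pole_holomorphic[OF openH] that by blast
qed

text \<open>
  If the factor \<open>p\<close> vanished at a pole of \<open>f\<close>, it could turn the pole into a removable singularity,
  while the product would still take the value \<open>0\<close> there.
\<close>
lemma nicely_meromorphic_on_mult_analytic:
  assumes f: "f nicely_meromorphic_on A" and p: "p analytic_on A"
    and nonzero: "\<And>z. z \<in> A \<Longrightarrow> is_pole f z \<Longrightarrow> p z \<noteq> 0"
  shows "(\<lambda>z. p z * f z) nicely_meromorphic_on A"
  unfolding nicely_meromorphic_on_def
proof (intro conjI ballI)
  show "(\<lambda>z. p z * f z) meromorphic_on A"
    using f analytic_on_imp_meromorphic_on[OF p] unfolding nicely_meromorphic_on_def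
    by (intro meromorphic_intros) auto
  fix z assume z: "z \<in> A"
  have pz: "p analytic_on {z}" using p z analytic_on_subset by blast
  show "is_pole (\<lambda>z. p z * f z) z \<and> p z * f z = 0 \<or> (\<lambda>z. p z * f z) \<midarrow>z\<rightarrow> p z * f z"
  proof (cases "is_pole f z")
    case True
    moreover from this have "f z = 0"
      using f z not_tendsto_and_filterlim_at_infinity[of "at z" f "f z"]
      by (auto simp: nicely_meromorphic_on_def is_pole_def)
    ultimately show ?thesis
      using is_pole_mult_analytic_nonzero1[OF True pz] nonzero[OF z] by simp
  next
    case False
    then have "f \<midarrow>z\<rightarrow> f z" using f z by (auto simp: nicely_meromorphic_on_def)
    moreover have "p \<midarrow>z\<rightarrow> p z"
      using analytic_at_imp_isCont[OF pz] by (simp add: isCont_def)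
    ultimately show ?thesis by (intro disjI2 tendsto_mult)
  qed
qed

lemma nicely_meromorphic_on_shift:
  assumes f: "f nicely_meromorphic_on UNIV"
  shows "(\<lambda>z. f (z + c)) nicely_meromorphic_on UNIV"
  unfolding nicely_meromorphic_on_def
proof (intro conjI ballI)
  show "(\<lambda>z. f (z + c)) meromorphic_on UNIV"
    using f unfolding nicely_meromorphic_on_def
    by (intro meromorphic_on_compose[of f UNIV "\<lambda>z. z + c"] analytic_intros) auto
  fix z
  have "is_pole (\<lambda>z. f (z + c)) z \<longleftrightarrow> is_pole f (z + c)"
    using is_pole_shift_iff[of f c z] by (simp add: o_def add_ac)
  moreover have "(\<lambda>z. f (z + c)) \<midarrow>z\<rightarrow> f (z + c)" if "f \<midarrow>z + c\<rightarrow> f (z + c)"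
    using LIM_offset[OF that, of c] by simp
  ultimately show "is_pole (\<lambda>z. f (z + c)) z \<and> f (z + c) = 0 \<or> (\<lambda>z. f (z + c)) \<midarrow>z\<rightarrow> f (z + c)"
    using f unfolding nicely_meromorphic_on_def by auto
qed

lemma binomial_zeta_nicely_meromorphic:
  assumes "i < a"
  shows "(\<lambda>s. ((s + of_nat i) gchoose i) * zeta (s + of_nat a + 1)) nicely_meromorphic_on UNIV"
proof (rule nicely_meromorphic_on_mult_analytic)
  show "(\<lambda>s. zeta (s + of_nat a + 1)) nicely_meromorphic_on UNIV"
    using nicely_meromorphic_on_shift[OF zeta_nicely_meromorphic, of "of_nat a + 1"] by (simp add: add.assoc)
  show "(\<lambda>s :: complex. (s + of_nat i) gchoose i) analytic_on UNIV"
    unfolding gbinomial_prod_rev by (intro analytic_intros) auto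
  fix s :: complex assume pole: "is_pole (\<lambda>s. zeta (s + of_nat a + 1)) s"
  show "(s + of_nat i) gchoose i \<noteq> 0"
  proof
    assume "(s + of_nat i) gchoose i = 0"
    then obtain j where j: "j < i" "s + of_nat i - of_nat j = 0"
      by (auto simp: gbinomial_prod_rev)
    \<comment> \<open>So \<open>s \<ge> -i\<close>, and \<open>i < a\<close> keeps \<open>s + a + 1\<close> strictly to the right of \<open>1\<close>.\<close>
    then have "Re s = real j - real i"
      by (metis add_diff_cancel_left' diff_add_cancel Re_complex_of_real of_real_of_nat_eq minus_complex.simps(1) right_minus_eq)
    then have "Re (s + (of_nat a + 1)) > 1" using j(1) assms by simp
    moreover have "is_pole zeta (s + (of_nat a + 1))"
      using pole is_pole_shift_iff[of zeta "of_nat a + 1" s] by (simp add: o_def add_ac)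
    ultimately show False using not_is_pole_zeta by blast
  qed
qed

section \<open>Change of variables for nonnegative integrals\<close>

text \<open>
  This connects integrals with values in the extended nonnegative reals to the notion of absolute
  integrability in which the one-dimensional change of variables theorem is stated.
\<close>
lemma set_nn_integral_eq_iff_absolutely_integrable:
  fixes f :: "real \<Rightarrow> real"
  assumes meas: "(\<lambda>x. indicator S x *\<^sub>R f x) \<in> borel_measurable borel"
    and nonneg: "\<And>x. x \<in> S \<Longrightarrow> f x \<ge> 0" and "b \<ge> 0"
  shows "(\<integral>\<^sup>+x\<in>S. ennreal (f x) \<partial>lborel) = ennreal b
    \<longleftrightarrow> f absolutely_integrable_on S \<and> integral S f = b"
proof -
  let ?F = "\<lambda>x. indicator S x *\<^sub>R f x"
  have meas': "?F \<in> borel_measurable lborel" using meas by simp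
  have "(\<integral>\<^sup>+x\<in>S. ennreal (f x) \<partial>lborel) = (\<integral>\<^sup>+x. ennreal (?F x) \<partial>lborel)"
    by (intro nn_integral_cong) (simp split: split_indicator)
  then have "(\<integral>\<^sup>+x\<in>S. ennreal (f x) \<partial>lborel) = ennreal b
      \<longleftrightarrow> integrable lborel ?F \<and> integral\<^sup>L lborel ?F = b"
    using nn_integral_eq_integrable[OF meas' _ \<open>b \<ge> 0\<close>] nonneg by (simp add: indicator_def)
  also have "\<dots> \<longleftrightarrow> set_integrable lebesgue S f \<and> (LINT x:S|lebesgue. f x) = b"
    unfolding set_integrable_def set_lebesgue_integral_def
    using integrable_completion[OF meas'] integral_completion[OF meas'] by simp
  also have "\<dots> \<longleftrightarrow> f absolutely_integrable_on S \<and> integral S f = b"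
    using set_lebesgue_integral_eq_integral(2)[of S f] by auto
  finally show ?thesis .
qed

lemma ennreal_eqI:
  fixes L R :: ennreal
  assumes "\<And>b. b \<ge> 0 \<Longrightarrow> L = ennreal b \<longleftrightarrow> R = ennreal b"
  shows "L = R"
proof (cases L)
  case (real r)
  then show ?thesis using assms[of r] by simp
next
  case top
  show ?thesis
  proof (cases R)
    case (real r)
    then show ?thesis using assms[of r] by simp
  qed (simp add: top)
qed

text \<open>
  For nonnegative functions the substitution rule also covers infinite integrals: one side has the
  finite value \<open>b\<close> exactly if the other has.
\<close>
lemma nn_integral_change_of_variables:
  fixes f g g' :: "real \<Rightarrow> real"
  assumes "open S" and T: "g ` S = T" "T \<in> sets borel"
    and der: "\<And>x. x \<in> S \<Longrightarrow> (g has_real_derivative g' x) (at x)"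
    and cont: "continuous_on S g'" and inj: "inj_on g S"
    and f [measurable]: "f \<in> borel_measurable borel" and nonneg: "\<And>y. y \<in> T \<Longrightarrow> f y \<ge> 0"
  shows "(\<integral>\<^sup>+y\<in>T. ennreal (f y) \<partial>lborel) = (\<integral>\<^sup>+x\<in>S. ennreal (\<bar>g' x\<bar> * f (g x)) \<partial>lborel)"
proof -
  have S [measurable]: "S \<in> sets borel" using \<open>open S\<close> by simp
  have "continuous_on S g"
    using der by (meson DERIV_isCont continuous_at_imp_continuous_on)
  then have [measurable]: "(\<lambda>x. indicator S x *\<^sub>R g x) \<in> borel_measurable borel"
    using S by (rule borel_measurable_continuous_on_indicator[rotated])
  have [measurable]: "(\<lambda>x. indicator S x *\<^sub>R g' x) \<in> borel_measurable borel"
    using S cont by (rule borel_measurable_continuous_on_indicator)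
  have "(\<lambda>x. \<bar>indicator S x *\<^sub>R g' x\<bar> * f (indicator S x *\<^sub>R g x)) \<in> borel_measurable borel"
    by measurable
  also have "(\<lambda>x. \<bar>indicator S x *\<^sub>R g' x\<bar> * f (indicator S x *\<^sub>R g x)) =
      (\<lambda>x. indicator S x *\<^sub>R (\<bar>g' x\<bar> * f (g x)))"
    by (auto simp: indicator_def)
  finally have meas: "(\<lambda>x. indicator S x *\<^sub>R (\<bar>g' x\<bar> * f (g x))) \<in> borel_measurable borel" .
  have meas': "(\<lambda>y. indicator T y *\<^sub>R f y) \<in> borel_measurable borel"
    using T by measurable
  have "(\<integral>\<^sup>+y\<in>T. ennreal (f y) \<partial>lborel) = ennreal b
      \<longleftrightarrow> (\<integral>\<^sup>+x\<in>S. ennreal (\<bar>g' x\<bar> * f (g x)) \<partial>lborel) = ennreal b" if "b \<ge> 0" for b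
  proof -
    have "(\<integral>\<^sup>+y\<in>T. ennreal (f y) \<partial>lborel) = ennreal b \<longleftrightarrow>
        f absolutely_integrable_on T \<and> integral T f = b"
      by (rule set_nn_integral_eq_iff_absolutely_integrable[OF meas' nonneg that])
    also have "\<dots> \<longleftrightarrow> (\<lambda>x. \<bar>g' x\<bar> * f (g x)) absolutely_integrable_on S \<and>
        integral S (\<lambda>x. \<bar>g' x\<bar> * f (g x)) = b"
      unfolding T(1)[symmetric]
      by (rule has_absolute_integral_change_of_variables_1'[OF _ _ inj, symmetric])
         (use S in auto, use der in \<open>blast intro: has_field_derivative_at_within\<close>)
    also have "\<dots> \<longleftrightarrow> (\<integral>\<^sup>+x\<in>S. ennreal (\<bar>g' x\<bar> * f (g x)) \<partial>lborel) = ennreal b"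
      using nonneg T(1)
      by (intro set_nn_integral_eq_iff_absolutely_integrable[OF meas _ that, symmetric]) auto
    finally show ?thesis .
  qed
  then show ?thesis by (rule ennreal_eqI)
qed

section \<open>From the triangle to the quadrant\<close>

abbreviation open_triangle :: "(real \<times> real) set" where
  "open_triangle \<equiv> {(t1, t2). 0 < t1 \<and> t1 < t2 \<and> t2 < 1}"

abbreviation open_quadrant :: "(real \<times> real) set" where
  "open_quadrant \<equiv> {0<..} \<times> {0<..}"

definition log_coords :: "real \<times> real \<Rightarrow> real \<times> real" where
  "log_coords = (\<lambda>(t1, t2). (ln (t2 / t1), ln ((1 - t1) / (1 - t2))))"

lemma measurable_log_coords [measurable]: "log_coords \<in> borel_measurable borel"
  unfolding log_coords_def borel_prod[symmetric] by measurable

lemma sets_open_triangle [measurable]: "open_triangle \<in> sets borel"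
proof -
  have "{p \<in> space (borel \<Otimes>\<^sub>M borel). 0 < fst p \<and> fst p < snd p \<and> snd p < (1::real)} \<in> sets (borel \<Otimes>\<^sub>M borel :: (real \<times> real) measure)"
    by measurable
  also have "{p \<in> space (borel \<Otimes>\<^sub>M borel). 0 < fst p \<and> fst p < snd p \<and> snd p < (1::real)} = open_triangle"
    by (auto simp: space_pair_measure)
  finally show ?thesis by (simp only: borel_prod)
qed

lemma sets_open_quadrant [measurable]: "open_quadrant \<in> sets borel"
  by (simp add: borel_open open_Times)

text \<open>
  The substitution \<open>t = y exp (-u)\<close>, that is \<open>u = ln (y / t)\<close>, for a fixed second coordinate \<open>y\<close> in the
  triangle.
\<close>
lemma nn_integral_first_coordinate:
  fixes y :: real
  assumes y: "0 < y" and f [measurable]: "f \<in> borel_measurable borel" and nonneg: "\<And>t. t \<in> {0<..<y} \<Longrightarrow> f t \<ge> 0"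
  shows "(\<integral>\<^sup>+t\<in>{0<..<y}. ennreal (f t) \<partial>lborel)
    = (\<integral>\<^sup>+u\<in>{0<..}. ennreal (y * exp (- u) * f (y * exp (- u))) \<partial>lborel)"
proof -
  have "(\<lambda>u. y * exp (- u)) ` {0<..} = {0<..<y}"
  proof (intro equalityI subsetI)
    fix t assume t: "t \<in> {0<..<y}"
    then have "t = y * exp (- ln (y / t))" "ln (y / t) > 0"
      using y by (auto simp: exp_minus)
    then show "t \<in> (\<lambda>u. y * exp (- u)) ` {0<..}" by blast
  qed (use y in auto)
  then have "(\<integral>\<^sup>+t\<in>{0<..<y}. ennreal (f t) \<partial>lborel)
    = (\<integral>\<^sup>+u\<in>{0<..}. ennreal (\<bar>- (y * exp (- u))\<bar> * f (y * exp (- u))) \<partial>lborel)"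
    using y nonneg
    by (intro nn_integral_change_of_variables)
       (auto intro!: derivative_eq_intros continuous_intros simp: inj_on_def)
  then show ?thesis using y by simp
qed

text \<open>
  The substitution \<open>v = ln ((1 - t x) / (1 - t))\<close> with inverse \<open>t = (exp v - 1) / (exp v - x)\<close>. In the
  application \<open>x = exp (-u)\<close> for a fixed \<open>u\<close>, so that \<open>t x\<close> is the first and \<open>t\<close> the second coordinate in
  the triangle.
\<close>
lemma nn_integral_second_coordinate:
  fixes x :: real
  assumes x: "0 < x" "x < 1" and f [measurable]: "f \<in> borel_measurable borel" and nonneg: "\<And>v. v \<in> {0<..} \<Longrightarrow> f v \<ge> 0"
  shows "(\<integral>\<^sup>+v\<in>{0<..}. ennreal (f v) \<partial>lborel)
    = (\<integral>\<^sup>+t\<in>{0<..<1}. ennreal ((1 - x) / ((1 - t) * (1 - t * x)) * f (ln ((1 - t * x) / (1 - t)))) \<partial>lborel)"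
proof -
  let ?g = "\<lambda>t. ln ((1 - t * x) / (1 - t))" and ?h = "\<lambda>v. (exp v - 1) / (exp v - x)"
  have pos: "1 - t * x > 0" "1 - t > 0" "1 - t * x > 1 - t" if "t \<in> {0<..<1}" for t
  proof -
    have "t * x < t" "t < 1" using that x by auto
    then show "1 - t * x > 0" "1 - t > 0" "1 - t * x > 1 - t" by linarith+
  qed
  have gpos: "?g t > 0" if "t \<in> {0<..<1}" for t
    using pos[OF that] by (intro ln_gt_zero) simp
  have hg: "?h (?g t) = t" if "t \<in> {0<..<1}" for t
  proof -
    have "exp (?g t) = (1 - t * x) / (1 - t)"
      using pos[OF that] by simp
    moreover have "(1 - t * x) / (1 - t) - 1 = t * (1 - x) / (1 - t)"
      "(1 - t * x) / (1 - t) - x = (1 - x) / (1 - t)"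
      using pos[OF that] by (auto simp: field_simps)
    ultimately show ?thesis using pos[OF that] x by simp
  qed
  have h: "?h v \<in> {0<..<1}" "?g (?h v) = v" if "v > 0" for v
  proof -
    have e: "exp v > 1" using that by simp
    then have "exp v - 1 > 0" "exp v - x > 0" "exp v - 1 < exp v - x" using x by linarith+
    then show "?h v \<in> {0<..<1}" by (simp add: divide_pos_pos)
    have "exp v \<noteq> x" using e x by linarith
    then have "1 - ?h v * x = exp v * (1 - x) / (exp v - x)" "1 - ?h v = (1 - x) / (exp v - x)"
      by (simp_all add: divide_simps) (simp_all add: algebra_simps)
    then have "(1 - ?h v * x) / (1 - ?h v) = exp v" using \<open>exp v \<noteq> x\<close> x by simp
    then show "?g (?h v) = v" by simp
  qed
  have img: "?g ` {0<..<1} = {0<..}"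
  proof (intro equalityI subsetI)
    fix v :: real assume "v \<in> {0<..}"
    then have "v = ?g (?h v)" "?h v \<in> {0<..<1}" using h[of v] by simp_all
    then show "v \<in> ?g ` {0<..<1}" by (rule image_eqI)
  qed (use gpos in auto)
  have inj: "inj_on ?g {0<..<1}"
    by (rule inj_on_inverseI[of _ ?h]) (rule hg)
  have der: "(?g has_real_derivative (1 - x) / ((1 - t) * (1 - t * x))) (at t)" if "t \<in> {0<..<1}" for t
  proof -
    have "((\<lambda>t. (1 - t * x) / (1 - t)) has_real_derivative (1 - x) / (1 - t)\<^sup>2) (at t)"
      using pos[OF that] by (auto intro!: derivative_eq_intros simp: field_simps power2_eq_square)
    then have "(?g has_real_derivative 1 / ((1 - t * x) / (1 - t)) * ((1 - x) / (1 - t)\<^sup>2)) (at t)"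
      using pos[OF that] by (intro DERIV_chain2[OF DERIV_ln_divide]) auto
    moreover have "1 / ((1 - t * x) / (1 - t)) * ((1 - x) / (1 - t)\<^sup>2) = (1 - x) / ((1 - t) * (1 - t * x))"
      using pos[OF that] by (simp add: power2_eq_square)
    ultimately show ?thesis by simp
  qed
  have "(\<integral>\<^sup>+v\<in>{0<..}. ennreal (f v) \<partial>lborel)
    = (\<integral>\<^sup>+t\<in>{0<..<1}. ennreal (\<bar>(1 - x) / ((1 - t) * (1 - t * x))\<bar> * f (?g t)) \<partial>lborel)"
    using pos by (intro nn_integral_change_of_variables img der inj f nonneg)
       (fastforce intro!: continuous_intros)+
  also have "\<dots> = (\<integral>\<^sup>+t\<in>{0<..<1}. ennreal ((1 - x) / ((1 - t) * (1 - t * x)) * f (?g t)) \<partial>lborel)"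
  proof (intro nn_integral_cong)
    fix t :: real
    have "\<bar>(1 - x) / ((1 - t) * (1 - t * x))\<bar> = (1 - x) / ((1 - t) * (1 - t * x))" if "t \<in> {0<..<1}"
      using pos[OF that] x by (intro abs_of_nonneg divide_nonneg_pos mult_pos_pos) auto
    then show "ennreal (\<bar>(1 - x) / ((1 - t) * (1 - t * x))\<bar> * f (?g t)) * indicator {0<..<1} t
        = ennreal ((1 - x) / ((1 - t) * (1 - t * x)) * f (?g t)) * indicator {0<..<1} t"
      by (cases "t \<in> {0<..<1}") simp_all
  qed
  finally show ?thesis .
qed

text \<open>
  The change to the coordinates \<open>(u, v)\<close>, one variable at a time: first \<open>t1\<close> is replaced by \<open>u\<close> for
  fixed \<open>t2\<close>, then, after exchanging the integrals, \<open>t2\<close> by \<open>v\<close> for fixed \<open>u\<close>. An equality of measures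
  transfers integrability and integrals of complex functions at once, although the substitutions
  are only made for nonnegative functions.
\<close>
lemma distr_log_coords:
  "distr (density lborel (\<lambda>p. ennreal (indicator open_triangle p / ((1 - fst p) * snd p)))) lborel log_coords
    = density lborel (\<lambda>p. ennreal (indicator open_quadrant p / (exp (fst p + snd p) - 1)))"
    (is "distr (density lborel ?tri) lborel log_coords = density lborel ?quad")
proof (rule measure_eqI)
  fix A assume "A \<in> sets (distr (density lborel ?tri) lborel log_coords)"
  then have A [measurable]: "A \<in> sets (borel :: (real \<times> real) measure)" by simp
  define G :: "real \<times> real \<Rightarrow> real" where "G = indicator A"
  have G [measurable]: "G \<in> borel_measurable (borel \<Otimes>\<^sub>M borel)"
    unfolding G_def borel_prod by measurable
  have G_nonneg: "G p \<ge> 0" for p by (simp add: G_def)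
  have tri [measurable]: "(\<lambda>p. indicator open_triangle p :: real) \<in> borel_measurable (borel \<Otimes>\<^sub>M borel)"
    and quad [measurable]: "(\<lambda>p. indicator open_quadrant p :: real) \<in> borel_measurable (borel \<Otimes>\<^sub>M borel)"
    and coords [measurable]: "log_coords \<in> measurable (borel \<Otimes>\<^sub>M borel) (borel \<Otimes>\<^sub>M borel)"
    unfolding borel_prod by measurable
  have tri_meas: "?tri \<in> borel_measurable borel" and quad_meas: "?quad \<in> borel_measurable borel"
    unfolding borel_prod[symmetric] by measurable
  \<comment> \<open>The integrand in the mixed coordinates \<open>u\<close> and \<open>t = t2\<close>.\<close>
  define K where "K = (\<lambda>(u, t). indicator {0<..} u * indicator {0<..<1} t *
      (exp (- u) / (1 - t * exp (- u)) * G (u, ln ((1 - t * exp (- u)) / (1 - t)))))"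
  have K [measurable]: "K \<in> borel_measurable (borel \<Otimes>\<^sub>M borel)"
    unfolding K_def by measurable
  have inner: "(\<integral>\<^sup>+t1. ennreal (indicator open_triangle (t1, t2) / ((1 - t1) * t2) * G (log_coords (t1, t2))) \<partial>lborel)
      = (\<integral>\<^sup>+u. ennreal (K (u, t2)) \<partial>lborel)" for t2
  proof (cases "t2 \<in> {0<..<1}")
    case True
    have "(\<integral>\<^sup>+t1. ennreal (indicator open_triangle (t1, t2) / ((1 - t1) * t2) * G (log_coords (t1, t2))) \<partial>lborel)
        = (\<integral>\<^sup>+t1\<in>{0<..<t2}. ennreal (1 / ((1 - t1) * t2) * G (log_coords (t1, t2))) \<partial>lborel)"
      using True by (intro nn_integral_cong) (auto simp: indicator_def)
    also have "\<dots> = (\<integral>\<^sup>+u\<in>{0<..}. ennreal (t2 * exp (- u) *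
        (1 / ((1 - t2 * exp (- u)) * t2) * G (log_coords (t2 * exp (- u), t2)))) \<partial>lborel)"
      using True G_nonneg by (intro nn_integral_first_coordinate) auto
    also have "\<dots> = (\<integral>\<^sup>+u. ennreal (K (u, t2)) \<partial>lborel)"
    proof (intro nn_integral_cong)
      fix u :: real
      have "t2 / (t2 * exp (- u)) = exp u" using True by (simp add: exp_minus field_simps)
      then have "log_coords (t2 * exp (- u), t2) = (u, ln ((1 - t2 * exp (- u)) / (1 - t2)))"
        by (simp add: log_coords_def)
      then show "ennreal (t2 * exp (- u) * (1 / ((1 - t2 * exp (- u)) * t2) * G (log_coords (t2 * exp (- u), t2))))
          * indicator {0<..} u = ennreal (K (u, t2))"
        using True by (simp add: K_def indicator_def)
    qed
    finally show ?thesis .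
  next
    case False
    then have "indicator open_triangle (t1, t2) = (0 :: real)" "K (u, t2) = 0" for t1 u
      by (auto simp: K_def indicator_def)
    then show ?thesis by simp
  qed
  have outer: "(\<integral>\<^sup>+t. ennreal (K (u, t)) \<partial>lborel)
      = (\<integral>\<^sup>+v. ennreal (indicator open_quadrant (u, v) / (exp (u + v) - 1) * G (u, v)) \<partial>lborel)" for u
  proof (cases "u > 0")
    case True
    let ?x = "exp (- u)"
    have x: "0 < ?x" "?x < 1" using True by auto
    have "(\<integral>\<^sup>+v. ennreal (indicator open_quadrant (u, v) / (exp (u + v) - 1) * G (u, v)) \<partial>lborel)
        = (\<integral>\<^sup>+v\<in>{0<..}. ennreal (1 / (exp (u + v) - 1) * G (u, v)) \<partial>lborel)"
      using True by (intro nn_integral_cong) (auto simp: indicator_def)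
    also have "\<dots> = (\<integral>\<^sup>+t\<in>{0<..<1}. ennreal ((1 - ?x) / ((1 - t) * (1 - t * ?x)) *
        (1 / (exp (u + ln ((1 - t * ?x) / (1 - t))) - 1) * G (u, ln ((1 - t * ?x) / (1 - t))))) \<partial>lborel)"
      using True G_nonneg by (intro nn_integral_second_coordinate x) auto
    also have "\<dots> = (\<integral>\<^sup>+t. ennreal (K (u, t)) \<partial>lborel)"
    proof (intro nn_integral_cong)
      fix t :: real
      let ?v = "ln ((1 - t * ?x) / (1 - t))"
      show "ennreal ((1 - ?x) / ((1 - t) * (1 - t * ?x)) * (1 / (exp (u + ?v) - 1) * G (u, ?v)))
          * indicator {0<..<1} t = ennreal (K (u, t))"
      proof (cases "t \<in> {0<..<1}")
        case t: True
        have "t * ?x < t" "t < 1" using t x by auto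
        then have pos: "1 - t * ?x > 0" "1 - t > 0" by linarith+
        \<comment> \<open>The product of \<open>1 / (exp (u + v) - 1)\<close> and \<open>dv / dt\<close> is the weight \<open>x / (1 - t x)\<close> in \<open>K\<close>.\<close>
        have "exp (u + ?v) - 1 = (1 - t * ?x) / (1 - t) / ?x - 1"
          using pos by (simp add: exp_add exp_minus field_simps)
        also have "\<dots> = (1 - ?x) / (?x * (1 - t))"
          using pos by (simp add: field_simps)
        finally have "(1 - ?x) / ((1 - t) * (1 - t * ?x)) * (1 / (exp (u + ?v) - 1)) = ?x / (1 - t * ?x)"
          using pos x by simp
        then have "(1 - ?x) / ((1 - t) * (1 - t * ?x)) * (1 / (exp (u + ?v) - 1) * G (u, ?v)) =
            ?x / (1 - t * ?x) * G (u, ?v)"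
          by (metis mult.assoc)
        then show ?thesis using t True by (simp add: K_def)
      qed (simp add: K_def)
    qed
    finally show ?thesis by simp
  next
    case False
    then show ?thesis by (simp add: K_def)
  qed
  have "emeasure (distr (density lborel ?tri) lborel log_coords) A
      = (\<integral>\<^sup>+p. ?tri p * indicator (log_coords -` A) p \<partial>lborel)"
    using tri_meas measurable_sets[OF measurable_log_coords A]
    by (subst emeasure_distr, simp, simp, subst emeasure_density) auto
  also have "\<dots> = (\<integral>\<^sup>+p. ennreal (indicator open_triangle p / ((1 - fst p) * snd p) * G (log_coords p)) \<partial>(lborel \<Otimes>\<^sub>M lborel))"
    unfolding lborel_prod
    by (intro nn_integral_cong) (auto simp: G_def indicator_def)
  also have "\<dots> = (\<integral>\<^sup>+t2. \<integral>\<^sup>+t1. ennreal (indicator open_triangle (t1, t2) / ((1 - t1) * t2) * G (log_coords (t1, t2))) \<partial>lborel \<partial>lborel)"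
    by (subst lborel_pair.nn_integral_snd [symmetric]) (auto simp: case_prod_unfold)
  also have "\<dots> = (\<integral>\<^sup>+t2. \<integral>\<^sup>+u. ennreal (K (u, t2)) \<partial>lborel \<partial>lborel)"
    by (simp only: inner)
  also have "\<dots> = (\<integral>\<^sup>+u. \<integral>\<^sup>+t2. ennreal (K (u, t2)) \<partial>lborel \<partial>lborel)"
    by (rule lborel_pair.Fubini') simp
  also have "\<dots> = (\<integral>\<^sup>+u. \<integral>\<^sup>+v. ennreal (indicator open_quadrant (u, v) / (exp (u + v) - 1) * G (u, v)) \<partial>lborel \<partial>lborel)"
    by (simp only: outer)
  also have "\<dots> = (\<integral>\<^sup>+p. ennreal (indicator open_quadrant p / (exp (fst p + snd p) - 1) * G p) \<partial>(lborel \<Otimes>\<^sub>M lborel))"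
    by (subst lborel.nn_integral_fst [symmetric]) (auto simp: case_prod_unfold)
  also have "\<dots> = (\<integral>\<^sup>+p. ?quad p * indicator A p \<partial>lborel)"
    unfolding lborel_prod
    by (intro nn_integral_cong) (auto simp: G_def indicator_def)
  also have "\<dots> = emeasure (density lborel ?quad) A"
    using quad_meas by (subst emeasure_density) auto
  finally show "emeasure (distr (density lborel ?tri) lborel log_coords) A = emeasure (density lborel ?quad) A" .
qed simp

section \<open>Gamma integrals\<close>

lemma has_bochner_integral_Gamma:
  assumes z: "Re z > 0"
  shows "has_bochner_integral lborel
    (\<lambda>u. indicator {0<..} u *\<^sub>R (of_real u powr (z - 1) * of_real (exp (- u)))) (Gamma z)"
proof -
  let ?f = "\<lambda>u::real. of_real u powr (z - 1) / of_real (exp u) :: complex"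
  have "continuous_on {0<..} ?f" by (auto intro!: continuous_intros)
  then have "(\<lambda>u. indicator {0<..} u *\<^sub>R ?f u) \<in> borel_measurable borel"
    by (intro borel_measurable_continuous_on_indicator) auto
  then have meas: "(\<lambda>u. indicator {0<..} u *\<^sub>R ?f u) \<in> borel_measurable lborel"
    by simp
  have "?f absolutely_integrable_on {0<..}"
    by (rule absolutely_integrable_Gamma_integral'[OF z])
  moreover have "integral {0<..} ?f = Gamma z"
    using Gamma_integral_complex'[OF z] by (rule integral_unique)
  ultimately have "set_integrable lebesgue {0<..} ?f" "(LINT u:{0<..}|lebesgue. ?f u) = Gamma z"
    using set_lebesgue_integral_eq_integral(2)[of "{0<..}" ?f] by auto
  then have "has_bochner_integral lborel (\<lambda>u. indicator {0<..} u *\<^sub>R ?f u) (Gamma z)"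
    unfolding set_integrable_def set_lebesgue_integral_def has_bochner_integral_iff
      integrable_completion[OF meas] integral_completion[OF meas] by blast
  then show ?thesis by (simp add: exp_minus divide_inverse)
qed

lemma has_bochner_integral_Gamma_scaled:
  assumes z: "Re z > 0" and c: "c > 0"
  shows "has_bochner_integral lborel
    (\<lambda>u. indicator {0<..} u *\<^sub>R (of_real u powr (z - 1) * of_real (exp (- (c * u)))))
    (Gamma z / of_real c powr z)"
proof -
  have "has_bochner_integral lborel
      (\<lambda>u. indicator {0<..} (0 + c * u) *\<^sub>R (of_real (0 + c * u) powr (z - 1) * of_real (exp (- (0 + c * u)))))
      (Gamma z /\<^sub>R \<bar>c\<bar>)"
    using lborel_has_bochner_integral_real_affine_iff[THEN iffD1, OF _ has_bochner_integral_Gamma[OF z], of c 0] c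
    by simp
  then have "has_bochner_integral lborel
      (\<lambda>u. of_real c powr (1 - z) * (indicator {0<..} (0 + c * u) *\<^sub>R
         (of_real (0 + c * u) powr (z - 1) * of_real (exp (- (0 + c * u))))))
      (of_real c powr (1 - z) * (Gamma z /\<^sub>R \<bar>c\<bar>))"
    by (rule has_bochner_integral_mult_right)
  moreover have "of_real c powr (1 - z) * (indicator {0<..} (0 + c * u) *\<^sub>R
         (of_real (0 + c * u) powr (z - 1) * of_real (exp (- (0 + c * u)))))
      = indicator {0<..} u *\<^sub>R (of_real u powr (z - 1) * of_real (exp (- (c * u))) :: complex)" for u
  proof (cases "u > 0")
    case True
    have "of_real (c * u) powr (z - 1) = of_real c powr (z - 1) * (of_real u powr (z - 1) :: complex)"
      using True c powr_times_real[of "of_real c" "of_real u" "z - 1"] by simp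
    moreover have "of_real c powr (1 - z) * of_real c powr (z - 1) = (1 :: complex)"
      using c powr_add[of "of_real c :: complex" "1 - z" "z - 1"] by simp
    ultimately show ?thesis using True c by simp
  next
    case False
    then have "\<not> c * u > 0" using c by (simp add: zero_less_mult_iff)
    then show ?thesis using False by simp
  qed
  moreover have "of_real c powr (1 - z) * (Gamma z /\<^sub>R \<bar>c\<bar>) = Gamma z / of_real c powr z"
    using c by (simp add: powr_diff scaleR_conv_of_real field_simps)
  ultimately show ?thesis by simp
qed

lemma has_bochner_integral_Gamma_scaled_real:
  fixes x c :: real
  assumes x: "x > 0" and c: "c > 0"
  shows "has_bochner_integral lborel
    (\<lambda>u. indicator {0<..} u * (u powr (x - 1) * exp (- (c * u)))) (Gamma x / c powr x)"
proof -
  have "has_bochner_integral lborel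
    (\<lambda>u. Re (indicator {0<..} u *\<^sub>R (of_real u powr (of_real x - 1) * of_real (exp (- (c * u))))))
    (Re (Gamma (of_real x) / of_real c powr of_real x))"
    using x c by (intro has_bochner_integral_Re has_bochner_integral_Gamma_scaled) auto
  moreover have "Re (indicator {0<..} u *\<^sub>R (of_real u powr (of_real x - 1) * of_real (exp (- (c * u)))))
      = indicator {0<..} u * (u powr (x - 1) * exp (- (c * u)))" for u
  proof (cases "u > 0")
    case True
    then have "of_real u powr (of_real x - 1 :: complex) = of_real (u powr (x - 1))"
      using powr_of_real[of u "x - 1"] by simp
    then show ?thesis using True by simp
  qed simp
  moreover have "Re (Gamma (of_real x) / of_real c powr of_real x) = Gamma x / c powr x"
    using c by (simp add: Gamma_complex_of_real powr_of_real flip: of_real_divide)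
  ultimately show ?thesis by (simp only:)
qed

lemma has_bochner_integral_product:
  fixes f g :: "real \<Rightarrow> 'a :: {real_normed_field, banach, second_countable_topology}"
  assumes f: "has_bochner_integral lborel f a" and g: "has_bochner_integral lborel g b"
  shows "has_bochner_integral lborel (\<lambda>p. f (fst p) * g (snd p)) (a * b)"
proof -
  have [measurable]: "f \<in> borel_measurable borel" "g \<in> borel_measurable borel"
    using f g has_bochner_integral_iff borel_measurable_integrable by force+
  have intf: "integrable lborel f" "integral\<^sup>L lborel f = a"
    and intg: "integrable lborel g" "integral\<^sup>L lborel g = b"
    using f g by (auto simp: has_bochner_integral_iff)
  have int: "integrable (lborel \<Otimes>\<^sub>M lborel) (\<lambda>p. f (fst p) * g (snd p))"
  proof (rule lborel_pair.Fubini_integrable)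
    show "integrable lborel (\<lambda>x. LINT y|lborel. norm (f (fst (x, y)) * g (snd (x, y))))"
      using intf by (simp add: norm_mult)
  qed (use intg in auto)
  have "(\<integral>p. f (fst p) * g (snd p) \<partial>(lborel \<Otimes>\<^sub>M lborel)) = a * b"
    using lborel_pair.integral_fst'[OF int] intf(2) intg(2) by simp
  with int show ?thesis
    unfolding lborel_prod by (simp add: has_bochner_integral_iff)
qed

section \<open>The integral over the quadrant\<close>

lemma exp_geometric_sums:
  fixes w :: real
  assumes "w > 0"
  shows "(\<lambda>n. exp (- (real (Suc n) * w))) sums (1 / (exp w - 1))"
proof -
  have "(\<lambda>n. exp (- w) * exp (- w) ^ n) sums (exp (- w) * (1 / (1 - exp (- w))))"
    using assms by (intro sums_mult geometric_sums) auto
  moreover have "exp (- w) * (1 / (1 - exp (- w))) = 1 / (exp w - 1)"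
    using assms by (simp add: exp_minus field_simps)
  moreover have "exp (- w) * exp (- w) ^ n = exp (- (real (Suc n) * w))" for n
    by (simp add: algebra_simps flip: exp_of_nat_mult exp_add)
  ultimately show ?thesis by simp
qed

text \<open>
  By the geometric series the integrand is the sum of the products \<open>f n\<close> of two Gamma integrands.
  Summation and integration may be exchanged because the integrals \<open>J n\<close> of the absolute values are
  the same expression with \<open>Re z\<close> in place of \<open>z\<close>, so that they decay like \<open>n^(-(Re z + m + 2))\<close>
  with an exponent beyond \<open>1\<close>.
\<close>
lemma has_bochner_integral_quadrant:
  assumes z: "Re z > -1"
  shows "has_bochner_integral lborel
    (\<lambda>p. (indicator open_quadrant p / (exp (fst p + snd p) - 1)) *\<^sub>R
       (of_real (fst p) powr z * of_real (snd p) ^ m))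
    (fact m * Gamma (z + 1) * (\<Sum>n. 1 / of_nat (Suc n) powr (z + of_nat m + 2)))"
    (is "has_bochner_integral lborel ?F ?I")
proof -
  \<comment> \<open>The exponent is written as \<open>w + 1 - 1\<close> to match the Gamma integral at \<open>w + 1\<close>.\<close>
  define A where "A = (\<lambda>(w::complex) (n::nat) u. indicator {0<..} u *\<^sub>R
      (of_real u powr (w + 1 - 1) * of_real (exp (- (real (Suc n) * u)))) :: complex)"
  define f where "f = (\<lambda>n p. A z n (fst p) * A (of_nat m) n (snd p))"
  define I where "I = (\<lambda>n. Gamma (z + 1) / of_real (real (Suc n)) powr (z + 1) *
      (Gamma (of_nat m + 1) / of_real (real (Suc n)) powr (of_nat m + 1)))"
  define J where "J = (\<lambda>n. Gamma (Re z + 1) / real (Suc n) powr (Re z + 1) *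
      (Gamma (real m + 1) / real (Suc n) powr (real m + 1)))"
  have f: "has_bochner_integral lborel (f n) (I n)" for n
    unfolding f_def I_def A_def using z
    by (intro has_bochner_integral_product has_bochner_integral_Gamma_scaled) auto
  have norm_A: "norm (A w n u) = indicator {0<..} u * (u powr (Re w + 1 - 1) * exp (- (real (Suc n) * u)))" for w n u
  proof (cases "u > 0")
    case True
    then have "norm (of_real u powr w :: complex) = u powr Re w"
      by (subst norm_powr_real_powr) auto
    then show ?thesis using True by (simp add: A_def norm_mult)
  qed (simp add: A_def)
  have norm_f: "has_bochner_integral lborel (\<lambda>p. norm (f n p)) (J n)" for n
    unfolding f_def J_def norm_mult norm_A of_nat_simps complex_Re_of_nat using z
    by (intro has_bochner_integral_product has_bochner_integral_Gamma_scaled_real) auto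
  have "summable (\<lambda>n. Gamma (Re z + 1) * Gamma (real m + 1) * real (Suc n) powr (- (Re z + real m + 2)))"
    using z by (intro summable_mult summable_Suc_powr) auto
  also have "(\<lambda>n. Gamma (Re z + 1) * Gamma (real m + 1) * real (Suc n) powr (- (Re z + real m + 2))) = J"
  proof
    fix n
    have "real (Suc n) powr (Re z + real m + 2) = real (Suc n) powr (Re z + 1) * real (Suc n) powr (real m + 1)"
      by (simp add: algebra_simps flip: powr_add)
    then show "Gamma (Re z + 1) * Gamma (real m + 1) * real (Suc n) powr (- (Re z + real m + 2)) = J n"
      by (simp only: J_def powr_minus_divide times_divide_eq_right times_divide_eq_left
          divide_divide_eq_left mult_1_right ac_simps)
  qed
  finally have sum_norm: "summable (\<lambda>n. \<integral>p. norm (f n p) \<partial>lborel)"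
    using norm_f by (simp add: has_bochner_integral_iff)
  have A_eq: "A w n u = of_real u powr w * of_real (exp (- (real (Suc n) * u)))" if "u > 0" for w n u
    using that by (simp add: A_def)
  have f_eq: "f n p = of_real (exp (- (real (Suc n) * (fst p + snd p)))) * (of_real (fst p) powr z * of_real (snd p) ^ m)"
    if "p \<in> open_quadrant" for n p
  proof -
    have "of_real (snd p) powr of_nat m = (of_real (snd p) ^ m :: complex)"
      using that by (auto simp: powr_nat')
    moreover have "exp (- (real (Suc n) * (fst p + snd p))) = exp (- (real (Suc n) * fst p)) * exp (- (real (Suc n) * snd p))"
      by (simp add: algebra_simps flip: exp_add)
    ultimately show ?thesis
      using that by (auto simp: f_def A_eq simp del: of_nat_Suc)
  qed
  have f_0: "f n p = 0" if "p \<notin> open_quadrant" for n p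
    using that by (cases p) (auto simp: f_def A_def)
  have f_sums: "(\<lambda>n. f n p) sums ?F p" for p
  proof (cases "p \<in> open_quadrant")
    case True
    then have "(\<lambda>n. exp (- (real (Suc n) * (fst p + snd p)))) sums (1 / (exp (fst p + snd p) - 1))"
      by (intro exp_geometric_sums) auto
    then have "(\<lambda>n. of_real (exp (- (real (Suc n) * (fst p + snd p)))) * (of_real (fst p) powr z * of_real (snd p) ^ m))
        sums (of_real (1 / (exp (fst p + snd p) - 1)) * (of_real (fst p) powr z * of_real (snd p) ^ m) :: complex)"
      by (intro sums_mult2 sums_of_real)
    then show ?thesis using True f_eq[OF True] by (simp add: scaleR_conv_of_real)
  qed (simp add: f_0)
  have summable_norm_f: "summable (\<lambda>n. norm (f n p))" for p
  proof (cases "p \<in> open_quadrant")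
    case True
    then have "(\<lambda>n. exp (- (real (Suc n) * (fst p + snd p)))) sums (1 / (exp (fst p + snd p) - 1))"
      by (intro exp_geometric_sums) auto
    then show ?thesis
      using f_eq[OF True] by (auto simp: norm_mult intro!: summable_mult2 dest: sums_summable simp del: of_nat_Suc)
  qed (simp add: f_0)
  have int_f: "integrable lborel (f n)" for n
    using f by (simp add: has_bochner_integral_iff)
  have F_eq: "?F = (\<lambda>p. \<Sum>n. f n p)"
    using f_sums by (simp add: sums_iff)
  have "integrable lborel ?F"
    unfolding F_eq using int_f summable_norm_f sum_norm by (intro integrable_suminf) auto
  moreover have "integral\<^sup>L lborel ?F = (\<Sum>n. I n)"
    unfolding F_eq using int_f summable_norm_f sum_norm f
    by (subst integral_suminf) (auto simp: has_bochner_integral_iff)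
  moreover have "(\<Sum>n. I n) = ?I"
  proof -
    have "I n = fact m * Gamma (z + 1) * (1 / of_nat (Suc n) powr (z + of_nat m + 2))" for n
    proof -
      have "(of_nat (Suc n) :: complex) powr (z + of_nat m + 2) = of_nat (Suc n) powr (z + 1) * of_nat (Suc n) powr (of_nat m + 1)"
        by (simp add: algebra_simps flip: powr_add)
      moreover have "Gamma (of_nat m + 1) = (fact m :: complex)"
        using Gamma_fact[of m, where 'a = complex] by (simp add: add.commute)
      ultimately show ?thesis by (simp add: I_def del: of_nat_Suc)
    qed
    then have "(\<Sum>n. I n) = (\<Sum>n. fact m * Gamma (z + 1) * (1 / of_nat (Suc n) powr (z + of_nat m + 2)))"
      by simp
    also have "\<dots> = ?I"
      using z by (intro suminf_mult sums_summable[OF zeta_series_sums]) auto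
    finally show ?thesis .
  qed
  ultimately show ?thesis by (simp add: has_bochner_integral_iff)
qed

section \<open>Evaluation of the coefficients\<close>

lemma integral_triangle:
  fixes F :: "real \<times> real \<Rightarrow> complex"
  assumes F [measurable]: "F \<in> borel_measurable borel"
  shows "(\<integral>p. (indicator open_triangle p / ((1 - fst p) * snd p)) *\<^sub>R F (log_coords p) \<partial>lborel)
    = (\<integral>p. (indicator open_quadrant p / (exp (fst p + snd p) - 1)) *\<^sub>R F p \<partial>lborel)"
proof -
  let ?tri = "\<lambda>p. indicator open_triangle p / ((1 - fst p) * snd p) :: real"
  let ?quad = "\<lambda>p. indicator open_quadrant p / (exp (fst p + snd p) - 1) :: real"
  have [measurable]: "(\<lambda>p. indicator open_triangle p :: real) \<in> borel_measurable (borel \<Otimes>\<^sub>M borel)"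
    "(\<lambda>p. indicator open_quadrant p :: real) \<in> borel_measurable (borel \<Otimes>\<^sub>M borel)"
    unfolding borel_prod by measurable
  have "?tri \<in> borel_measurable borel" and "?quad \<in> borel_measurable borel"
    unfolding borel_prod[symmetric] by measurable
  then have meas: "?tri \<in> borel_measurable lborel" "?quad \<in> borel_measurable lborel" by simp_all
  have FL: "(\<lambda>p. F (log_coords p)) \<in> borel_measurable lborel" "F \<in> borel_measurable lborel" by simp_all
  have nonneg: "?tri p \<ge> 0" "?quad p \<ge> 0" for p
    by (auto simp: indicator_def)
  have "(\<integral>p. ?tri p *\<^sub>R F (log_coords p) \<partial>lborel) = (\<integral>p. F (log_coords p) \<partial>density lborel ?tri)"
    using integral_density[OF FL(1) meas(1)] nonneg by simp
  also have "\<dots> = integral\<^sup>L (distr (density lborel ?tri) lborel log_coords) F"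
    by (subst integral_distr) simp_all
  also have "\<dots> = integral\<^sup>L (density lborel ?quad) F"
    by (simp only: distr_log_coords)
  also have "\<dots> = (\<integral>p. ?quad p *\<^sub>R F p \<partial>lborel)"
    using integral_density[OF FL(2) meas(2)] nonneg by simp
  finally show ?thesis .
qed

text \<open>
  The coefficient of \<open>T^i\<close> carries the power \<open>i\<close> of \<open>u = ln (t2 / t1)\<close>, which raises the exponent \<open>s\<close> to
  \<open>s + i\<close>; this shift is the origin of the factor \<open>Gamma (s+i+1) / Gamma (s+1)\<close>, and hence of the
  binomial coefficient.
\<close>
lemma I_integral_eq:
  assumes "i < a" and s: "Re s > -1"
  shows "I_integral a i s = ((s + of_nat i) gchoose i) * zeta (s + of_nat a + 1)"
proof -
  define m where "m = a - 1 - i"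
  have a: "a = m + i + 1" using assms by (simp add: m_def)
  define C where "C = (of_nat ((m + i) choose i) :: complex)"
  \<comment> \<open>The cut-off to \<open>u > 0\<close>, where the power is continuous, gives the measurability of \<open>F\<close>.\<close>
  define F where "F = (\<lambda>p. (indicator {0<..} (fst p) *\<^sub>R of_real (fst p) powr (s + of_nat i)) * of_real (snd p) ^ m :: complex)"
  define Z where "Z = (\<Sum>n. 1 / of_nat (Suc n) powr (s + of_nat a + 1) :: complex)"
  have "(\<lambda>u::real. indicator {0<..} u *\<^sub>R (of_real u powr (s + of_nat i) :: complex)) \<in> borel_measurable borel"
    by (rule borel_measurable_continuous_on_indicator) (auto intro!: continuous_intros)
  then have F_meas: "F \<in> borel_measurable borel"
    unfolding F_def borel_prod[symmetric] by measurable
  have integrand: "indicator open_triangle t *\<^sub>R I_integrand a i s t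
      = C * ((indicator open_triangle t / ((1 - fst t) * snd t)) *\<^sub>R F (log_coords t))" for t
  proof (cases "t \<in> open_triangle")
    case True
    obtain t1 t2 where t: "t = (t1, t2)" by (cases t)
    let ?L = "ln ((1 - t1) / (1 - t2))" and ?M = "ln (t2 / t1)"
    have M: "?M > 0" using True t by auto
    have "coeff ([: ?L, ?M :] ^ (a - 1)) i = of_nat ((m + i) choose i) * ?M ^ i * ?L ^ m"
      using coeff_linear_poly_power[of i "m + i" ?L ?M] by (simp add: a)
    moreover have "of_real ?M powr (s + of_nat i) = of_real ?M powr s * (of_real ?M ^ i :: complex)"
      using M by (simp add: powr_add powr_nat')
    ultimately show ?thesis
      using True M by (simp add: t I_integrand_def F_def log_coords_def C_def scaleR_conv_of_real)
  qed simp
  have "(LINT t:open_triangle|lborel. I_integrand a i s t)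
      = C * (\<integral>p. (indicator open_triangle p / ((1 - fst p) * snd p)) *\<^sub>R F (log_coords p) \<partial>lborel)"
    unfolding set_lebesgue_integral_def integrand by (rule integral_mult_right_zero)
  also have "(\<integral>p. (indicator open_triangle p / ((1 - fst p) * snd p)) *\<^sub>R F (log_coords p) \<partial>lborel)
      = (\<integral>p. (indicator open_quadrant p / (exp (fst p + snd p) - 1)) *\<^sub>R F p \<partial>lborel)"
    by (rule integral_triangle[OF F_meas])
  also have "\<dots> = (\<integral>p. (indicator open_quadrant p / (exp (fst p + snd p) - 1)) *\<^sub>R
       (of_real (fst p) powr (s + of_nat i) * of_real (snd p) ^ m) \<partial>lborel)"
    by (intro Bochner_Integration.integral_cong) (auto simp: F_def indicator_def)
  also have "\<dots> = fact m * Gamma (s + of_nat i + 1) * Z"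
    using has_bochner_integral_quadrant[of "s + of_nat i" m] s
    by (simp add: has_bochner_integral_iff Z_def a algebra_simps)
  finally have "I_integral a i s = 1 / (fact (m + i) * Gamma (s + 1)) * (C * (fact m * Gamma (s + of_nat i + 1) * Z))"
    by (simp add: I_integral_def a)
  moreover have "C = fact (m + i) / (fact i * fact m)"
    unfolding C_def by (simp add: binomial_fact)
  moreover have nonpos: "s + 1 \<notin> \<int>\<^sub>\<le>\<^sub>0"
    using s by (auto elim!: nonpos_Ints_cases simp: complex_eq_iff)
  then have "Gamma (s + of_nat i + 1) = pochhammer (s + 1) i * Gamma (s + 1)" "Gamma (s + 1) \<noteq> 0"
    using pochhammer_Gamma[of "s + 1" i] Gamma_eq_zero_iff[of "s + 1"] by (auto simp: algebra_simps)
  moreover have "(s + of_nat i) gchoose i = pochhammer (s + 1) i / fact i"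
    by (simp add: gbinomial_pochhammer')
  moreover have "zeta (s + of_nat a + 1) = Z"
    unfolding Z_def using s by (intro zeta_eq_series) (simp add: a)
  ultimately show ?thesis by simp
qed

theorem theorem5p2:
  fixes a :: nat and s :: complex
  assumes "a \<ge> 1"
  shows "I_poly a s =
    smult (zeta (s + of_nat a + 1)) (\<Sum>i=0..a-1. monom ((s + of_nat i) gchoose i) i)"
proof -
  let ?H = "{s. Re s > -1}"
  have H: "open ?H" by (rule open_halfspace_Re_gt)
  have "(0::complex) \<in> ?H" by simp
  then have nonempty: "?H \<noteq> {}" by blast
  have "meromorphic_continuation ?H (I_integral a i) = (\<lambda>s. ((s + of_nat i) gchoose i) * zeta (s + of_nat a + 1))"
    if "i < a" for i
    by (rule meromorphic_continuation_eqI[OF binomial_zeta_nicely_meromorphic[OF that] H nonempty])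
       (simp add: I_integral_eq[OF that])
  then have "I_poly a s = (\<Sum>i<a. monom (((s + of_nat i) gchoose i) * zeta (s + of_nat a + 1)) i)"
    unfolding I_poly_def by (intro sum.cong) auto
  also have "{..<a} = {0..a-1}" using assms by auto
  finally show ?thesis
    by (auto intro!: poly_eqI sum.cong simp: coeff_sum sum_distrib_left)
qed

end
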